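(* Let $M$ be Hrushovski's countable non-collapsed structure for a symmetric ternary relation $R$, let $M_s$ be its $S$-reduct, regarded as an $S$-structure, and let $\mathcal{C}_s$ be the age of $M_s$, i.e. the class of finite $S$-structures isomorphic to a substructure of $M_s$. Then $$\mathcal{C}_s=\{A : A\text{ is a finite }S\text{-structure with }\emptyset\leqslant_s A\}.$$ In addition, every finite $S$-structure $A$ with $\emptyset\leqslant_s A$ is strongly embeddable into $M_s$.
   Context: The structure $M$. An $R$-structure is a set with a symmetric ternary relation $R$ holding only of triples of pairwise distinct elements. For finite $A$, $d_0(A)=|A|-r(A)$ where $r(A)$ is the number of three-element subsets $\{x,y,z\}\subseteq A$ with $R(x,y,z)$. For finite $A\subseteq N$, $A\leqslant N$ means $d_0(B)\ge d_0(A)$ for all finite $B$ with $A\subseteq B\subseteq N$. $\mathcal{C}$ is the class of finite $R$-structures $A$ with $\emptyset\leqslant A$. $M$ is the unique (up to isomorphism) countable $R$-structure all of whose finite substructures lie in $\mathcal{C}$ and such that whenever $A\leqslant M$ is finite and $A\leqslant B\in\mathcal{C}$ there is an embedding $f:B\to M$ over $A$ with $f(B)\leqslant M$. $S$-structures. An $S$-structure is a set $A$ with a family $C(A)$ of subsets of $A$ of size $\ge 3$ (declared maximal cliques) and a function $\mathfrak{m}_A:C(A)\to\{1,2,3\}$ (pre-multiplicity) which is valid: putting $m_A(X)=\sum_{C\in C(A),X\subseteq C}\mathfrak{m}_A(C)$ for $X\subseteq A$ with $|X|\ge3$ (and $m_A(X)=0$ if $|X|<3$), one has $m_A(X)\le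 1+\frac{2}{|X|-2}$ whenever $|X|\ge 3$. A subset $A'\subseteq A$ carries the induced structure $C(A')=\{C\cap A':C\in C(A),|C\cap A'|\ge3\}$, $\mathfrak{m}_{A'}(D)=\sum_{C\in C(A),C\cap A'=D}\mathfrak{m}_A(C)$; these are the substructures. An embedding is an injection that is an isomorphism (preserving cliques and multiplicities both ways) onto the induced structure on its image. For finite $A$, $d_{0s}(A)=|A|-\sum_{C\in C(A)}\mathfrak{m}_A(C)(|C|-2)$. For a finite substructure $A\subseteq N$, $A\leqslant_s N$ ("strong") means $d_{0s}(D)\ge d_{0s}(A)$ for every finite $D$ with $A\subseteq D\subseteq N$; an embedding is strong if its image is strong in the target. $M_s$ is the $S$-structure with universe $M$, $C(M_s)$ the family of sets $\{c\in M:R(c,x,y)\}$ ($x\ne y$ in $M$) with at least $3$ elements, and $\mathfrak{m}(C)$ the number of unordered pairs $\{x,y\}$ with $C=\{c:R(c,x,y)\}$. (This is the reduct of $M$ to $S(x_1,x_2,x_3):=\exists x_4,x_5\bigwedge_{i}R(x_i,x_4,x_5)\wedge\bigwedge_{i\ne j}x_i\neq x_j$, together with multiplicities.) *)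

theory Defs
  imports Complex_Main "HOL-Library.Countable_Set"
begin

record 'a rstr =
  runiv :: "'a set"
  rrel :: "'a \<Rightarrow> 'a \<Rightarrow> 'a \<Rightarrow> bool"

definition R_structure :: "'a rstr \<Rightarrow> bool" where
  "R_structure A \<longleftrightarrow>
     (\<forall>x y z. rrel A x y z \<longrightarrow>
        x \<in> runiv A \<and> y \<in> runiv A \<and> z \<in> runiv A \<and>
        x \<noteq> y \<and> x \<noteq> z \<and> y \<noteq> z \<and>
        rrel A y x z \<and> rrel A x z y)"

definition R_induced :: "'a rstr \<Rightarrow> 'a set \<Rightarrow> 'a rstr" where
  "R_induced N X =
     \<lparr>runiv = X,
      rrel = (\<lambda>x y z. x \<in> X \<and> y \<in> X \<and> z \<in> X \<and> rrel N x y z)\<rparr>"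

definition R_count :: "'a rstr \<Rightarrow> nat" where
  "R_count A =
     card {T. T \<subseteq> runiv A \<and> card T = 3 \<and> (\<exists>x y z. T = {x, y, z} \<and> rrel A x y z)}"

definition d0 :: "'a rstr \<Rightarrow> int" where
  "d0 A = int (card (runiv A)) - int (R_count A)"

definition R_strong :: "'a set \<Rightarrow> 'a rstr \<Rightarrow> bool" where
  "R_strong X N \<longleftrightarrow>
     finite X \<and> X \<subseteq> runiv N \<and>
     (\<forall>Y. finite Y \<and> X \<subseteq> Y \<and> Y \<subseteq> runiv N \<longrightarrow> d0 (R_induced N Y) \<ge> d0 (R_induced N X))"

definition class_C :: "'a rstr set" where
  "class_C = {A. R_structure A \<and> finite (runiv A) \<and> R_strong {} A}"

definition R_embedding :: "('a \<Rightarrow> 'b) \<Rightarrow> 'a rstr \<Rightarrow> 'b rstr \<Rightarrow> bool" where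
  "R_embedding f A B \<longleftrightarrow>
     inj_on f (runiv A) \<and> f ` runiv A \<subseteq> runiv B \<and>
     (\<forall>x \<in> runiv A. \<forall>y \<in> runiv A. \<forall>z \<in> runiv A. rrel A x y z \<longleftrightarrow> rrel B (f x) (f y) (f z))"

text \<open>
  In the extension property the finite structure \<open>B\<close> ranges over structures on sets of natural
  numbers, which represent all finite structures up to isomorphism.  Hence \<open>X\<close> is not literally
  a subset of \<open>B\<close> but is identified with its image under \<open>g\<close>, and the requirement that the
  embedding \<open>f\<close> be over \<open>X\<close> becomes \<open>f (g x) = x\<close>.
\<close>

definition R_generic :: "'a rstr \<Rightarrow> bool" where
  "R_generic M \<longleftrightarrow>
     R_structure M \<and> countable (runiv M) \<and>
     (\<forall>X. finite X \<and> X \<subseteq> runiv M \<longrightarrow> R_induced M X \<in> class_C) \<and>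
     (\<forall>X (B :: nat rstr) g.
        R_strong X M \<and> B \<in> class_C \<and>
        R_embedding g (R_induced M X) B \<and> R_strong (g ` X) B \<longrightarrow>
        (\<exists>f. R_embedding f B M \<and> (\<forall>x \<in> X. f (g x) = x) \<and> R_strong (f ` runiv B) M))"

text \<open>
  Only the values of \<open>smult\<close> on \<open>scliques\<close> are meaningful.
\<close>

record 'a sstr =
  suniv :: "'a set"
  scliques :: "'a set set"
  smult :: "'a set \<Rightarrow> nat"

text \<open>Cliques may be infinite, whereas \<^term>\<open>card X = 0\<close> for infinite \<open>X\<close>.\<close>

definition size_ge3 :: "'a set \<Rightarrow> bool" where
  "size_ge3 X \<longleftrightarrow> infinite X \<or> card X \<ge> 3"

definition mult_of :: "'a sstr \<Rightarrow> 'a set \<Rightarrow> nat" where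
  "mult_of A X =
     (if size_ge3 X then (\<Sum>C \<in> {C \<in> scliques A. X \<subseteq> C}. smult A C) else 0)"

text \<open>
  The finiteness requirement says that the sum defining \<^term>\<open>mult_of A X\<close> is finite; without it
  the bound would hold vacuously, as \<^const>\<open>sum\<close> is \<open>0\<close> on infinite index sets.  For infinite \<open>X\<close>
  the term \<open>2 / (card X - 2)\<close> is read as \<open>0\<close>.
\<close>

definition S_valid :: "'a sstr \<Rightarrow> bool" where
  "S_valid A \<longleftrightarrow>
     (\<forall>X. X \<subseteq> suniv A \<and> size_ge3 X \<longrightarrow>
        finite {C \<in> scliques A. X \<subseteq> C} \<and>
        real (mult_of A X) \<le> 1 + (if finite X then 2 / (real (card X) - 2) else 0))"

definition S_structure :: "'a sstr \<Rightarrow> bool" where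
  "S_structure A \<longleftrightarrow>
     (\<forall>C \<in> scliques A. C \<subseteq> suniv A \<and> size_ge3 C \<and> smult A C \<in> {1, 2, 3}) \<and>
     S_valid A"

definition S_induced :: "'a sstr \<Rightarrow> 'a set \<Rightarrow> 'a sstr" where
  "S_induced N X =
     \<lparr>suniv = X,
      scliques = {C \<inter> X | C. C \<in> scliques N \<and> size_ge3 (C \<inter> X)},
      smult = (\<lambda>D. \<Sum>C \<in> {C \<in> scliques N. C \<inter> X = D}. smult N C)\<rparr>"

definition S_iso :: "('a \<Rightarrow> 'b) \<Rightarrow> 'a sstr \<Rightarrow> 'b sstr \<Rightarrow> bool" where
  "S_iso f A B \<longleftrightarrow>
     bij_betw f (suniv A) (suniv B) \<and>
     (\<lambda>C. f ` C) ` scliques A = scliques B \<and>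
     (\<forall>C \<in> scliques A. smult B (f ` C) = smult A C)"

definition S_embedding :: "('a \<Rightarrow> 'b) \<Rightarrow> 'a sstr \<Rightarrow> 'b sstr \<Rightarrow> bool" where
  "S_embedding f A N \<longleftrightarrow>
     inj_on f (suniv A) \<and> f ` suniv A \<subseteq> suniv N \<and> S_iso f A (S_induced N (f ` suniv A))"

definition d0s :: "'a sstr \<Rightarrow> int" where
  "d0s A = int (card (suniv A)) - (\<Sum>C \<in> scliques A. int (smult A C) * (int (card C) - 2))"

definition S_strong :: "'a set \<Rightarrow> 'a sstr \<Rightarrow> bool" where
  "S_strong X N \<longleftrightarrow>
     finite X \<and> X \<subseteq> suniv N \<and>
     (\<forall>D. finite D \<and> X \<subseteq> D \<and> D \<subseteq> suniv N \<longrightarrow> d0s (S_induced N D) \<ge> d0s (S_induced N X))"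

definition S_strong_embedding :: "('a \<Rightarrow> 'b) \<Rightarrow> 'a sstr \<Rightarrow> 'b sstr \<Rightarrow> bool" where
  "S_strong_embedding f A N \<longleftrightarrow> S_embedding f A N \<and> S_strong (f ` suniv A) N"

definition S_age :: "'b sstr \<Rightarrow> 'a sstr set" where
  "S_age N =
     {A. S_structure A \<and> finite (suniv A) \<and> (\<exists>X f. X \<subseteq> suniv N \<and> S_iso f A (S_induced N X))}"

definition link :: "'a rstr \<Rightarrow> 'a \<Rightarrow> 'a \<Rightarrow> 'a set" where
  "link M x y = {c \<in> runiv M. rrel M c x y}"

definition S_reduct :: "'a rstr \<Rightarrow> 'a sstr" where
  "S_reduct M =
     \<lparr>suniv = runiv M,
      scliques =
        {link M x y | x y. x \<in> runiv M \<and> y \<in> runiv M \<and> x \<noteq> y \<and> size_ge3 (link M x y)},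
      smult = (\<lambda>C. card {{x, y} | x y. x \<in> runiv M \<and> y \<in> runiv M \<and> x \<noteq> y \<and> C = link M x y})\<rparr>"

end

theory Submission
  imports Defs
begin

text \<open>
  Regard an R-structure as a 3-uniform hypergraph, and call \<open>c\<close> an apex of a two-element set \<open>p\<close>
  if \<open>p \<union> {c}\<close> is an edge.  The cliques of the reduct are the apex sets with at least three
  elements, and the multiplicity of a clique counts the pairs that produce it.  Counting by pairs
  instead of cliques gives, for finite \<open>D\<close>,
  \<open>d0s(D) = |D| - (\<Sum>p. |apexes(p) \<inter> D| - 2)\<close>, where \<open>p\<close> ranges over the heavy pairs, those with at
  least three apexes in \<open>D\<close>.  So both assertions are upper bounds on such sums.

  The bound comes from an orientation.  If \<open>B\<close> is strong in \<open>M\<close>, then any set \<open>J\<close> of edges not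
  contained in \<open>B\<close> covers at least \<open>|J|\<close> points outside \<open>B\<close>, so by Hall's theorem
  finitely many such edges can be sent injectively to points that lie on them and outside \<open>B\<close>.
  For a pair \<open>p\<close> not contained in \<open>B\<close>, at most two of the edges on \<open>p\<close> are sent into \<open>p\<close> itself,
  so all but two are sent to their apex; and an edge that is sent to its apex determines the pair,
  which is what remains of it.  For a pair inside \<open>B\<close>, every edge with apex outside \<open>B\<close> is sent to
  its apex.  Hence, apart from what the pairs inside \<open>B\<close> contribute through apexes in \<open>D \<inter> B\<close>, the sum
  is at most \<open>|D - B|\<close> (lemma \<open>sum_apexes_le\<close>).  With \<open>B = {}\<close> this says that the predimension
  of \<open>M_s\<close> is nonnegative on finite sets, which gives one inclusion for the age.

  For the other inclusion and the strong embedding, let \<open>A\<close> be a finite S-structure with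
  \<open>{} \<le> A\<close>.  Attach to each clique \<open>C\<close> as many disjoint new pairs, called hinges, as its
  multiplicity demands, and make \<open>C\<close> the apex set of each of its hinges.  A hinge adds two points and
  \<open>|C|\<close> edges, exactly the amount \<open>|C| - 2\<close> that \<open>d0s\<close> subtracts, so the resulting
  R-structure is in \<open>class_C\<close> and embeds in \<open>M\<close> with strong image \<open>B\<close>.  A pair with at least three
  apexes in \<open>B\<close> lies in \<open>B\<close> by strongness, and the only such pairs inside \<open>B\<close> are the hinges.  Therefore \<open>M_s\<close>
  induces on the image of \<open>A\<close> precisely the structure of \<open>A\<close>.  Strongness of this image is
  \<open>sum_apexes_le\<close> again, for this \<open>B\<close>: among the pairs inside \<open>B\<close> only the hinges
  count, and their apexes in \<open>B\<close> are already in the image of \<open>A\<close>.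
\<close>

section \<open>Hall's marriage theorem\<close>

text \<open>
  The argument of Halmos and Vaughan: either some nonempty proper subfamily is tight, and it and the
  rest can be matched separately because the rest keeps Hall's condition after removal of the
  points of the tight part; or there is slack everywhere and one may match any index arbitrarily.
\<close>

lemma hall_marriage:
  fixes A :: "'i \<Rightarrow> 'a set"
  assumes "finite I" "\<And>i. i \<in> I \<Longrightarrow> finite (A i)"
    and "\<And>J. J \<subseteq> I \<Longrightarrow> card J \<le> card (\<Union>(A ` J))"
  shows "\<exists>f. inj_on f I \<and> (\<forall>i\<in>I. f i \<in> A i)"
  using assms
proof (induction "card I" arbitrary: I A rule: less_induct)
  case less
  note finI = less.prems(1) and finA = less.prems(2) and hall = less.prems(3)
  show ?case
  proof (cases "\<exists>K. K \<subset> I \<and> K \<noteq> {} \<and> card (\<Union>(A ` K)) = card K")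
    case True
    then obtain K where K: "K \<subset> I" "K \<noteq> {}" "card (\<Union>(A ` K)) = card K" by blast
    define U where "U = \<Union>(A ` K)"
    have finK: "finite K" using K(1) finI finite_subset by blast
    have finU: "finite U" unfolding U_def using finK finA K(1) by blast
    have "\<exists>f. inj_on f K \<and> (\<forall>i\<in>K. f i \<in> A i)"
    proof (rule less.hyps)
      show "card K < card I" using K(1) finI by (simp add: psubset_card_mono)
      show "finite K" by (fact finK)
      show "finite (A i)" if "i \<in> K" for i using that K(1) finA by blast
      show "card J \<le> card (\<Union>(A ` J))" if "J \<subseteq> K" for J using that K(1) hall by blast
    qed
    then obtain f where "inj_on f K \<and> (\<forall>i\<in>K. f i \<in> A i)" ..
    then have f: "inj_on f K" "\<And>i. i \<in> K \<Longrightarrow> f i \<in> A i" by simp_all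
    have "\<exists>g. inj_on g (I - K) \<and> (\<forall>i\<in>I - K. g i \<in> A i - U)"
    proof (rule less.hyps)
      show "card (I - K) < card I" using K(1,2) by (intro psubset_card_mono[OF finI]) blast
      show "finite (I - K)" using finI by simp
      show "finite (A i - U)" if "i \<in> I - K" for i using that finA by blast
      show "card J \<le> card (\<Union>i\<in>J. A i - U)" if J: "J \<subseteq> I - K" for J
      proof -
        have finJ: "finite J" using J finI finite_subset by blast
        have finW: "finite (\<Union>i\<in>J. A i - U)" using finJ finA J by blast
        have "card J + card K = card (J \<union> K)"
          using J finJ finK by (subst card_Un_disjoint) auto
        also have "\<dots> \<le> card (\<Union>(A ` (J \<union> K)))" using J K(1) by (intro hall) blast
        also have "\<Union>(A ` (J \<union> K)) = (\<Union>i\<in>J. A i - U) \<union> U" unfolding U_def by auto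
        also have "card \<dots> = card (\<Union>i\<in>J. A i - U) + card U"
          using finW finU by (subst card_Un_disjoint) auto
        finally show ?thesis using K(3) unfolding U_def by simp
      qed
    qed
    then obtain g where "inj_on g (I - K) \<and> (\<forall>i\<in>I - K. g i \<in> A i - U)" ..
    then have g: "inj_on g (I - K)" "\<And>i. i \<in> I - K \<Longrightarrow> g i \<in> A i - U" by simp_all
    define h where "h i = (if i \<in> K then f i else g i)" for i
    have fU: "f i \<in> U" if "i \<in> K" for i using f(2) that unfolding U_def by blast
    have "inj_on h I"
    proof (rule inj_onI)
      fix i j assume ij: "i \<in> I" "j \<in> I" "h i = h j"
      show "i = j"
      proof (cases "i \<in> K"; cases "j \<in> K")
        assume "i \<in> K" "j \<in> K" then show ?thesis using ij f(1) unfolding h_def by (simp add: inj_on_eq_iff)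
      next
        assume "i \<in> K" "j \<notin> K" then show ?thesis using ij fU[of i] g(2)[of j] unfolding h_def by auto
      next
        assume "i \<notin> K" "j \<in> K" then show ?thesis using ij fU[of j] g(2)[of i] unfolding h_def by auto
      next
        assume "i \<notin> K" "j \<notin> K" then show ?thesis using ij g(1) unfolding h_def by (simp add: inj_on_eq_iff)
      qed
    qed
    moreover have "\<forall>i\<in>I. h i \<in> A i" using f(2) g(2) unfolding h_def by auto
    ultimately show ?thesis by blast
  next
    case False
    show ?thesis
    proof (cases "I = {}")
      case True
      then show ?thesis by simp
    next
      case ne: False
      then obtain i where i: "i \<in> I" by blast
      have "card {i} \<le> card (\<Union>(A ` {i}))" using i by (intro hall) blast
      then have "A i \<noteq> {}" by auto
      then obtain x where x: "x \<in> A i" by blast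
      have "\<exists>g. inj_on g (I - {i}) \<and> (\<forall>j\<in>I - {i}. g j \<in> A j - {x})"
      proof (rule less.hyps)
        show "card (I - {i}) < card I" using i finI by (meson card_Diff1_less)
        show "finite (I - {i})" using finI by simp
        show "finite (A j - {x})" if "j \<in> I - {i}" for j using that finA by blast
        show "card J \<le> card (\<Union>j\<in>J. A j - {x})" if J: "J \<subseteq> I - {i}" for J
        proof (cases "J = {}")
          case True
          then show ?thesis by simp
        next
          case neJ: False
          have finJ: "finite J" using J finI finite_subset by blast
          have JI: "J \<subset> I" using J i by blast
          have "card J \<le> card (\<Union>(A ` J))" using JI by (intro hall) blast
          moreover have "card (\<Union>(A ` J)) \<noteq> card J" using False JI neJ by blast
          ultimately have "card J \<le> card (\<Union>(A ` J)) - 1" by simp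
          also have "\<dots> \<le> card (\<Union>(A ` J) - {x})" by (simp add: card_Diff_singleton_if)
          also have "\<Union>(A ` J) - {x} = (\<Union>j\<in>J. A j - {x})" by auto
          finally show ?thesis .
        qed
      qed
      then obtain g where "inj_on g (I - {i}) \<and> (\<forall>j\<in>I - {i}. g j \<in> A j - {x})" ..
      then have g: "inj_on g (I - {i})" "\<And>j. j \<in> I - {i} \<Longrightarrow> g j \<in> A j - {x}" by simp_all
      have "x \<notin> g ` (I - {i})" using g(2) by blast
      moreover from this have "inj_on (g(i := x)) (I - {i})" by (intro inj_on_fun_updI g(1))
      ultimately have "inj_on (g(i := x)) (insert i (I - {i}))"
        unfolding inj_on_insert by auto
      then have "inj_on (g(i := x)) I" using i by (simp add: insert_absorb)
      moreover have "\<forall>j\<in>I. (g(i := x)) j \<in> A j" using g(2) x by auto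
      ultimately show ?thesis by blast
    qed
  qed
qed

section \<open>R-structures as 3-uniform hypergraphs\<close>

definition edges :: "'a rstr \<Rightarrow> 'a set set" where
  "edges N = {T. \<exists>x y z. T = {x, y, z} \<and> rrel N x y z}"

definition apexes :: "'a rstr \<Rightarrow> 'a set \<Rightarrow> 'a set" where
  "apexes N p = {c. c \<notin> p \<and> insert c p \<in> edges N}"

lemma edgesD:
  assumes "R_structure N" "T \<in> edges N"
  shows "T \<subseteq> runiv N" "card T = 3" "finite T"
proof -
  obtain x y z where T: "T = {x, y, z}" "rrel N x y z" using assms(2) unfolding edges_def by blast
  then have "x \<noteq> y" "x \<noteq> z" "y \<noteq> z" "x \<in> runiv N" "y \<in> runiv N" "z \<in> runiv N"
    using assms(1) unfolding R_structure_def by metis+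
  then show "T \<subseteq> runiv N" "card T = 3" "finite T" using T by auto
qed

text \<open>
  By symmetry the relation depends only on the underlying set, so nothing is lost by passing
  from the ternary relation to edges.
\<close>

lemma rrel_iff_edge:
  assumes "R_structure N" "card {x, y, z} = 3"
  shows "rrel N x y z \<longleftrightarrow> {x, y, z} \<in> edges N"
proof
  assume "{x, y, z} \<in> edges N"
  then obtain a b c where abc: "{x, y, z} = {a, b, c}" "rrel N a b c" unfolding edges_def by blast
  have sym: "rrel N u v w \<Longrightarrow> rrel N v u w \<and> rrel N u w v" for u v w
    using assms(1) unfolding R_structure_def by blast
  have all: "rrel N a b c" "rrel N a c b" "rrel N b a c" "rrel N b c a" "rrel N c a b" "rrel N c b a"
    using sym abc(2) by blast+
  have d: "x \<noteq> y" "x \<noteq> z" "y \<noteq> z" using assms(2) by (auto simp: card_insert_if split: if_splits)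
  have "x \<in> {a, b, c}" "y \<in> {a, b, c}" "z \<in> {a, b, c}" using abc(1) by auto
  then show "rrel N x y z" using d all by auto
qed (auto simp: edges_def)

lemma rrel_distinct:
  assumes "R_structure N" "rrel N x y z"
  shows "card {x, y, z} = 3"
  using assms edgesD(2)[of N "{x, y, z}"] unfolding edges_def by blast

lemma apexes_subset: "R_structure N \<Longrightarrow> apexes N p \<subseteq> runiv N"
  using edgesD(1) unfolding apexes_def by blast

lemma link_eq_apexes:
  assumes "R_structure N" "x \<noteq> y"
  shows "link N x y = apexes N {x, y}"
proof -
  have "rrel N c x y \<longleftrightarrow> c \<notin> {x, y} \<and> {c, x, y} \<in> edges N" for c
  proof
    assume r: "rrel N c x y"
    then have "card {c, x, y} = 3" by (rule rrel_distinct[OF assms(1)])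
    then show "c \<notin> {x, y} \<and> {c, x, y} \<in> edges N"
      using r assms(2) by (auto simp: edges_def card_insert_if split: if_splits)
  next
    assume "c \<notin> {x, y} \<and> {c, x, y} \<in> edges N"
    moreover from this have "card {c, x, y} = 3" using assms(2) by auto
    ultimately show "rrel N c x y" using rrel_iff_edge[OF assms(1)] by blast
  qed
  moreover have "rrel N c x y \<Longrightarrow> c \<in> runiv N" for c using assms(1) unfolding R_structure_def by blast
  ultimately show ?thesis unfolding link_def apexes_def by auto
qed

lemma d0_induced:
  assumes "R_structure N"
  shows "d0 (R_induced N Y) = int (card Y) - int (card (edges N \<inter> Pow Y))"
proof -
  have "{T. T \<subseteq> Y \<and> card T = 3 \<and> (\<exists>x y z. T = {x, y, z} \<and> x \<in> Y \<and> y \<in> Y \<and> z \<in> Y \<and> rrel N x y z)}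
      = edges N \<inter> Pow Y" (is "?L = ?R")
  proof (intro equalityI subsetI)
    fix T assume T: "T \<in> ?R"
    then obtain x y z where xyz: "T = {x, y, z}" "rrel N x y z" unfolding edges_def by blast
    moreover have "card T = 3" using T edgesD(2)[OF assms] by blast
    moreover have "x \<in> Y" "y \<in> Y" "z \<in> Y" using T xyz(1) by auto
    ultimately show "T \<in> ?L" using T by blast
  qed (auto simp: edges_def)
  then show ?thesis unfolding d0_def R_count_def R_induced_def by simp
qed

lemma R_strong_iff:
  assumes "R_structure N"
  shows "R_strong X N \<longleftrightarrow> finite X \<and> X \<subseteq> runiv N \<and>
     (\<forall>Y. finite Y \<and> X \<subseteq> Y \<and> Y \<subseteq> runiv N \<longrightarrow>
        card X + card (edges N \<inter> Pow Y) \<le> card Y + card (edges N \<inter> Pow X))"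
  unfolding R_strong_def d0_induced[OF assms] by (auto simp: algebra_simps; fastforce)

lemma R_strong_empty_iff:
  assumes "R_structure N"
  shows "R_strong {} N \<longleftrightarrow>
     (\<forall>Y. finite Y \<and> Y \<subseteq> runiv N \<longrightarrow> card (edges N \<inter> Pow Y) \<le> card Y)"
proof -
  have "edges N \<inter> Pow {} = {}" using edgesD(2)[OF assms] by fastforce
  then show ?thesis unfolding R_strong_iff[OF assms] by simp
qed

lemma edges_image:
  assumes "R_structure A" "R_structure B" "R_embedding f A B" "Y \<subseteq> runiv A"
  shows "edges B \<inter> Pow (f ` Y) = (`) f ` (edges A \<inter> Pow Y)"
proof (intro equalityI subsetI)
  fix T assume "T \<in> edges B \<inter> Pow (f ` Y)"
  then obtain x y z where T: "T = {x, y, z}" "rrel B x y z" "T \<subseteq> f ` Y" unfolding edges_def by auto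
  then have "x \<in> f ` Y" "y \<in> f ` Y" "z \<in> f ` Y" by auto
  then obtain a b c where abc: "a \<in> Y" "b \<in> Y" "c \<in> Y" "x = f a" "y = f b" "z = f c"
    by (elim imageE)
  moreover from this have "a \<in> runiv A" "b \<in> runiv A" "c \<in> runiv A" using assms(4) by auto
  ultimately have "rrel A a b c" using T(2) assms(3) unfolding R_embedding_def by simp
  then show "T \<in> (`) f ` (edges A \<inter> Pow Y)"
    using abc T by (intro image_eqI[of _ _ "{a, b, c}"]) (auto simp: edges_def)
next
  fix T assume "T \<in> (`) f ` (edges A \<inter> Pow Y)"
  then obtain a b c where "T = f ` {a, b, c}" "rrel A a b c" "{a, b, c} \<subseteq> Y" unfolding edges_def by auto
  moreover from this have "a \<in> runiv A" "b \<in> runiv A" "c \<in> runiv A" using assms(4) by auto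
  then have "rrel B (f a) (f b) (f c)" using \<open>rrel A a b c\<close> assms(3) unfolding R_embedding_def by simp
  ultimately show "T \<in> edges B \<inter> Pow (f ` Y)" unfolding edges_def by auto
qed

lemma apexes_image:
  assumes "R_structure A" "R_structure B" "R_embedding f A B" "p \<subseteq> runiv A"
  shows "apexes B (f ` p) \<inter> f ` runiv A = f ` apexes A p"
proof -
  have inj: "inj_on f (runiv A)" using assms(3) unfolding R_embedding_def by blast
  have "f c \<in> apexes B (f ` p) \<longleftrightarrow> c \<in> apexes A p" if c: "c \<in> runiv A" for c
  proof -
    have "f c \<in> f ` p \<longleftrightarrow> c \<in> p" using inj c assms(4) by (rule inj_on_image_mem_iff)
    moreover have "insert (f c) (f ` p) \<in> edges B \<longleftrightarrow> insert c p \<in> edges A"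
    proof -
      have "insert (f c) (f ` p) \<in> edges B \<longleftrightarrow> f ` insert c p \<in> edges B \<inter> Pow (f ` runiv A)"
        using c assms(4) by auto
      also have "\<dots> \<longleftrightarrow> f ` insert c p \<in> (`) f ` (edges A \<inter> Pow (runiv A))"
        using edges_image[OF assms(1-3) order_refl] by simp
      also have "\<dots> \<longleftrightarrow> insert c p \<in> edges A"
      proof
        assume "f ` insert c p \<in> (`) f ` (edges A \<inter> Pow (runiv A))"
        then obtain T where "T \<in> edges A" "T \<subseteq> runiv A" "f ` insert c p = f ` T" by blast
        then show "insert c p \<in> edges A"
          using inj c assms(4) inj_on_image_eq_iff[of f "runiv A" "insert c p" T] by auto
      next
        assume "insert c p \<in> edges A"
        then show "f ` insert c p \<in> (`) f ` (edges A \<inter> Pow (runiv A))"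
          using c assms(4) by (intro imageI) auto
      qed
      finally show ?thesis .
    qed
    ultimately show ?thesis unfolding apexes_def by auto
  qed
  then show ?thesis using apexes_subset[OF assms(1), of p] by blast
qed

section \<open>Counting apexes over a strong set\<close>

text \<open>
  Strength of \<open>B\<close>, applied to \<open>B\<close> together with the points of a set of edges, is Hall's
  condition for the family of sets \<open>T - B\<close>.
\<close>

lemma R_strong_orientation:
  assumes N: "R_structure N" and B: "R_strong B N"
    and E: "finite E" "E \<subseteq> runiv N"
  obtains \<phi> where "inj_on \<phi> {T \<in> edges N. T \<subseteq> E \<and> \<not> T \<subseteq> B}"
    and "\<And>T. T \<in> edges N \<Longrightarrow> T \<subseteq> E \<Longrightarrow> \<not> T \<subseteq> B \<Longrightarrow> \<phi> T \<in> T - B"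
proof -
  let ?I = "{T \<in> edges N. T \<subseteq> E \<and> \<not> T \<subseteq> B}"
  note strong = B[unfolded R_strong_iff[OF N]]
  have "\<exists>\<phi>. inj_on \<phi> ?I \<and> (\<forall>T\<in>?I. \<phi> T \<in> T - B)"
  proof (rule hall_marriage[of ?I "\<lambda>T. T - B"])
    show "finite ?I" by (rule finite_subset[of _ "Pow E"]) (use E in auto)
    show "finite (T - B)" if "T \<in> ?I" for T using that E finite_subset by blast
    show "card J \<le> card (\<Union>T\<in>J. T - B)" if J: "J \<subseteq> ?I" for J
    proof -
      let ?U = "\<Union>T\<in>J. T - B"
      have finU: "finite ?U" by (rule finite_subset[of _ E]) (use E J in auto)
      have finB: "finite B" using strong by blast
      have finY: "finite (B \<union> ?U)" using finU finB by simp
      have finJ: "finite J" by (rule finite_subset[of _ "Pow E"]) (use E J in auto)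
      have "card J + card (edges N \<inter> Pow B) = card (J \<union> edges N \<inter> Pow B)"
        using finJ finB J by (subst card_Un_disjoint) auto
      also have "\<dots> \<le> card (edges N \<inter> Pow (B \<union> ?U))"
        by (rule card_mono) (use finY J in auto)
      finally have "card J + card (edges N \<inter> Pow B) \<le> card (edges N \<inter> Pow (B \<union> ?U))" .
      moreover have "B \<union> ?U \<subseteq> runiv N" using strong J E by blast
      then have "card B + card (edges N \<inter> Pow (B \<union> ?U)) \<le> card (B \<union> ?U) + card (edges N \<inter> Pow B)"
        using strong finY by blast
      moreover have "card (B \<union> ?U) = card B + card ?U"
        using finB finU by (subst card_Un_disjoint) auto
      ultimately show ?thesis by linarith
    qed
  qed
  then obtain \<phi> where \<phi>: "inj_on \<phi> ?I \<and> (\<forall>T\<in>?I. \<phi> T \<in> T - B)" ..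
  show ?thesis
  proof (rule that[of \<phi>])
    show "inj_on \<phi> ?I" using \<phi> by (rule conjunct1)
    show "\<phi> T \<in> T - B" if "T \<in> edges N" "T \<subseteq> E" "\<not> T \<subseteq> B" for T
      using that by (intro bspec[OF conjunct2[OF \<phi>]]) simp
  qed
qed

text \<open>
  The central estimate.  Untruncated subtraction on the right makes it sharper: a pair inside \<open>B\<close> may have
  many apexes in \<open>D\<close> but fewer than two in \<open>D \<inter> B\<close>, and then its summand there is negative.
\<close>

lemma sum_apexes_le:
  assumes N: "R_structure N" and B: "R_strong B N"
    and D: "finite D" "D \<subseteq> runiv N"
    and P: "finite P" "\<And>p. p \<in> P \<Longrightarrow> p \<subseteq> runiv N \<and> card p = 2"
  shows "(\<Sum>p\<in>P. int (card (apexes N p \<inter> D)) - 2)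
    \<le> int (card (D - B)) + (\<Sum>p\<in>{p \<in> P. p \<subseteq> B}. int (card (apexes N p \<inter> (D \<inter> B))) - 2)"
proof -
  have finp: "finite p" if "p \<in> P" for p using P(2)[OF that] by (simp add: card_ge_0_finite)
  define E where "E = D \<union> \<Union>P"
  have E: "finite E" "E \<subseteq> runiv N" unfolding E_def using D P finp by auto
  obtain \<phi> where inj: "inj_on \<phi> {T \<in> edges N. T \<subseteq> E \<and> \<not> T \<subseteq> B}"
    and \<phi>: "\<And>T. T \<in> edges N \<Longrightarrow> T \<subseteq> E \<Longrightarrow> \<not> T \<subseteq> B \<Longrightarrow> \<phi> T \<in> T - B"
    using R_strong_orientation[OF N B E] by blast
  \<comment> \<open>Apexes to which the edge over \<open>p\<close> is sent; such an edge can serve only one pair.\<close>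
  define G where "G p = {c \<in> apexes N p \<inter> D. \<not> insert c p \<subseteq> B \<and> \<phi> (insert c p) = c}" for p
  have apexE: "insert c p \<in> edges N" "insert c p \<subseteq> E" "c \<notin> p"
    if "p \<in> P" "c \<in> apexes N p \<inter> D" for p c
    using that unfolding apexes_def E_def by auto
  have apexI: "insert c p \<in> {T \<in> edges N. T \<subseteq> E \<and> \<not> T \<subseteq> B}"
    if "p \<in> P" "c \<in> apexes N p \<inter> D" "\<not> insert c p \<subseteq> B" for p c
    using apexE[OF that(1,2)] that(3) by simp
  have GD: "G p \<subseteq> D - B" if "p \<in> P" for p
    using \<phi> apexE[OF that] unfolding G_def by fastforce
  have finG: "finite (G p)" for p unfolding G_def using D by simp
  have disj: "G p \<inter> G q = {}" if pq: "p \<in> P" "q \<in> P" "p \<noteq> q" for p q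
  proof (rule ccontr)
    assume "G p \<inter> G q \<noteq> {}"
    then obtain c where c: "c \<in> G p" "c \<in> G q" by blast
    then have cap: "c \<in> apexes N p \<inter> D" "c \<in> apexes N q \<inter> D"
      and out: "\<not> insert c p \<subseteq> B" "\<not> insert c q \<subseteq> B"
      and eq: "\<phi> (insert c p) = \<phi> (insert c q)"
      unfolding G_def by auto
    have "insert c p = insert c q"
      by (rule inj_onD[OF inj eq apexI[OF pq(1) cap(1) out(1)] apexI[OF pq(2) cap(2) out(2)]])
    moreover have "c \<notin> p" "c \<notin> q" using apexE(3)[OF pq(1) cap(1)] apexE(3)[OF pq(2) cap(2)] .
    ultimately show False using pq(3) by (simp add: insert_ident)
  qed
  have "(\<Sum>p\<in>P. card (G p)) = card (\<Union>(G ` P))"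
    using P(1) finG disj by (subst card_UN_disjoint) auto
  also have "\<dots> \<le> card (D - B)" by (rule card_mono) (use D GD in auto)
  finally have sumG: "(\<Sum>p\<in>P. int (card (G p))) \<le> int (card (D - B))"
    by (metis of_nat_le_iff of_nat_sum)
  have each: "int (card (apexes N p \<inter> D)) - 2
      \<le> int (card (G p)) + (if p \<subseteq> B then int (card (apexes N p \<inter> (D \<inter> B))) - 2 else 0)"
    if p: "p \<in> P" for p
  proof (cases "p \<subseteq> B")
    case True
    have "apexes N p \<inter> D \<subseteq> G p \<union> apexes N p \<inter> (D \<inter> B)"
    proof
      fix c assume c: "c \<in> apexes N p \<inter> D"
      show "c \<in> G p \<union> apexes N p \<inter> (D \<inter> B)"
      proof (cases "c \<in> B")
        case False
        \<comment> \<open>Here \<open>c\<close> is the only point of the edge outside \<open>B\<close>.\<close>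
        then have "\<phi> (insert c p) \<in> insert c p - B" using apexE[OF p c] \<phi> by blast
        then show ?thesis using True False c unfolding G_def by auto
      qed (use c in auto)
    qed
    then have "card (apexes N p \<inter> D) \<le> card (G p \<union> apexes N p \<inter> (D \<inter> B))"
      using D finG by (intro card_mono) auto
    also have "\<dots> \<le> card (G p) + card (apexes N p \<inter> (D \<inter> B))" by (rule card_Un_le)
    finally show ?thesis using True by simp
  next
    case False
    \<comment> \<open>The edges of the remaining apexes are sent injectively into the two points of \<open>p\<close>.\<close>
    let ?R = "apexes N p \<inter> D - G p"
    have "card ?R \<le> card p"
    proof (rule card_inj_on_le)
      show "inj_on (\<lambda>c. \<phi> (insert c p)) ?R"
      proof (rule inj_onI)
        fix c d assume cd: "c \<in> ?R" "d \<in> ?R" "\<phi> (insert c p) = \<phi> (insert d p)"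
        then have cd': "c \<in> apexes N p \<inter> D" "d \<in> apexes N p \<inter> D" by auto
        have "insert c p = insert d p"
          by (rule inj_onD[OF inj cd(3) apexI[OF p cd'(1)] apexI[OF p cd'(2)]]) (use False in auto)
        moreover have "c \<notin> p" "d \<notin> p" using cd' apexE(3)[OF p] by blast+
        ultimately show "c = d" by blast
      qed
      show "(\<lambda>c. \<phi> (insert c p)) ` ?R \<subseteq> p"
      proof
        fix x assume "x \<in> (\<lambda>c. \<phi> (insert c p)) ` ?R"
        then obtain c where c: "c \<in> apexes N p \<inter> D" "c \<notin> G p" "x = \<phi> (insert c p)" by blast
        have out: "\<not> insert c p \<subseteq> B" using False by blast
        have "x \<in> insert c p" using \<phi>[OF apexE(1,2)[OF p c(1)] out] c(3) by blast
        moreover have "x \<noteq> c" using c out unfolding G_def by auto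
        ultimately show "x \<in> p" by blast
      qed
      show "finite p" by (rule finp[OF p])
    qed
    then have "card ?R \<le> 2" using P(2)[OF p] by simp
    moreover have "card (apexes N p \<inter> D) = card (G p) + card ?R"
    proof -
      have "apexes N p \<inter> D = G p \<union> ?R" unfolding G_def by blast
      then show ?thesis using finG[of p] D(1) by (metis Diff_disjoint card_Un_disjoint finite_Diff finite_Int)
    qed
    ultimately show ?thesis using False by simp
  qed
  have "(\<Sum>p\<in>P. int (card (apexes N p \<inter> D)) - 2)
     \<le> (\<Sum>p\<in>P. int (card (G p)) + (if p \<subseteq> B then int (card (apexes N p \<inter> (D \<inter> B))) - 2 else 0))"
    by (intro sum_mono each)
  also have "\<dots> = (\<Sum>p\<in>P. int (card (G p)))
     + (\<Sum>p\<in>{p \<in> P. p \<subseteq> B}. int (card (apexes N p \<inter> (D \<inter> B))) - 2)"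
    using P(1) by (simp add: sum.distrib sum.inter_filter)
  finally show ?thesis using sumG by linarith
qed

section \<open>Heavy pairs and the reduct\<close>

definition heavy :: "'a rstr \<Rightarrow> 'a set \<Rightarrow> 'a set set" where
  "heavy N X = {p. p \<subseteq> runiv N \<and> card p = 2 \<and> size_ge3 (apexes N p \<inter> X)}"

lemma size_ge3_finite: "finite X \<Longrightarrow> size_ge3 X \<longleftrightarrow> card X \<ge> 3"
  unfolding size_ge3_def by simp

lemma size_ge3_mono: "size_ge3 X \<Longrightarrow> X \<subseteq> Y \<Longrightarrow> size_ge3 Y"
  unfolding size_ge3_def by (meson card_mono finite_subset le_trans)

text \<open>
  Truncated subtraction makes pairs with fewer than three apexes in \<open>D\<close> contribute \<open>0\<close>, so the
  bound holds for every finite set of pairs.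
\<close>

lemma sum_heavy_le:
  assumes "R_structure N" "R_strong {} N" "finite D" "D \<subseteq> runiv N"
    and "finite P" "\<And>p. p \<in> P \<Longrightarrow> p \<subseteq> runiv N \<and> card p = 2"
  shows "(\<Sum>p\<in>P. card (apexes N p \<inter> D) - 2) \<le> card D"
proof -
  let ?Q = "{p \<in> P. 2 \<le> card (apexes N p \<inter> D)}"
  have "p \<noteq> {}" if "p \<in> P" for p using assms(6)[OF that] by auto
  then have e: "{p \<in> ?Q. p \<subseteq> {}} = {}" by blast
  have "(\<Sum>p\<in>P. card (apexes N p \<inter> D) - 2) = (\<Sum>p\<in>?Q. card (apexes N p \<inter> D) - 2)"
    by (rule sum.mono_neutral_right) (use assms(5) in auto)
  also have "int \<dots> = (\<Sum>p\<in>?Q. int (card (apexes N p \<inter> D)) - 2)"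
    unfolding of_nat_sum by (rule sum.cong) auto
  also have "\<dots> \<le> int (card (D - {})) + (\<Sum>p\<in>{p \<in> ?Q. p \<subseteq> {}}. int (card (apexes N p \<inter> (D \<inter> {}))) - 2)"
    by (rule sum_apexes_le[OF assms(1-4)]) (use assms(5,6) in auto)
  also have "\<dots> = int (card D)" unfolding e by simp
  finally show ?thesis by (simp only: of_nat_le_iff)
qed

text \<open>
  A heavy pair contributes at least \<open>1\<close> to a sum bounded by the size of \<open>D\<close>.  The sums over cliques
  below would be \<open>0\<close> by convention if there were infinitely many heavy pairs.
\<close>

lemma finite_heavy:
  assumes "R_structure N" "R_strong {} N" "finite D" "D \<subseteq> runiv N"
  shows "finite (heavy N D)"
proof (rule finite_if_finite_subsets_card_bdd[of _ "card D", THEN conjunct1])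
  fix P assume P: "P \<subseteq> heavy N D" "finite P"
  have "card P = (\<Sum>p\<in>P. 1)" by simp
  also have "\<dots> \<le> (\<Sum>p\<in>P. card (apexes N p \<inter> D) - 2)"
    using P assms(3) by (intro sum_mono) (auto simp: heavy_def size_ge3_finite)
  also have "\<dots> \<le> card D"
    by (rule sum_heavy_le[OF assms P(2)]) (use P(1) in \<open>auto simp: heavy_def\<close>)
  finally show "card P \<le> card D" .
qed

lemma scliques_reduct:
  assumes "R_structure M"
  shows "scliques (S_reduct M) = apexes M ` heavy M UNIV"
proof -
  have "C \<in> scliques (S_reduct M) \<longleftrightarrow> C \<in> apexes M ` heavy M UNIV" for C
  proof
    assume "C \<in> scliques (S_reduct M)"
    then obtain x y where "x \<in> runiv M" "y \<in> runiv M" "x \<noteq> y" "size_ge3 (link M x y)" "C = link M x y"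
      unfolding S_reduct_def by auto
    then show "C \<in> apexes M ` heavy M UNIV"
      using link_eq_apexes[OF assms] by (intro image_eqI[of _ _ "{x, y}"]) (auto simp: heavy_def)
  next
    assume "C \<in> apexes M ` heavy M UNIV"
    then obtain p where p: "C = apexes M p" "p \<subseteq> runiv M" "card p = 2" "size_ge3 (apexes M p)"
      unfolding heavy_def by auto
    then obtain x y where "p = {x, y}" "x \<noteq> y" by (meson card_2_iff)
    moreover from this have "C = link M x y" using p(1) link_eq_apexes[OF assms, of x y] by simp
    moreover have "x \<in> runiv M" "y \<in> runiv M" using p(2) \<open>p = {x, y}\<close> by auto
    moreover have "size_ge3 (link M x y)" using p(1,4) \<open>C = link M x y\<close> by simp
    ultimately show "C \<in> scliques (S_reduct M)"
      unfolding S_reduct_def by auto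
  qed
  then show ?thesis by blast
qed

lemma smult_reduct:
  assumes "R_structure M"
  shows "smult (S_reduct M) C = card {p. p \<subseteq> runiv M \<and> card p = 2 \<and> apexes M p = C}"
proof -
  have "{{x, y} | x y. x \<in> runiv M \<and> y \<in> runiv M \<and> x \<noteq> y \<and> C = link M x y}
     = {p. p \<subseteq> runiv M \<and> card p = 2 \<and> apexes M p = C}" (is "?L = ?R")
  proof (intro equalityI subsetI)
    fix p assume "p \<in> ?L"
    then show "p \<in> ?R" using link_eq_apexes[OF assms] by auto
  next
    fix p assume p: "p \<in> ?R"
    then obtain x y where "p = {x, y}" "x \<noteq> y" by (auto simp: card_2_iff)
    moreover from this have "C = link M x y" using p link_eq_apexes[OF assms, of x y] by simp
    moreover have "x \<in> runiv M" "y \<in> runiv M" using p \<open>p = {x, y}\<close> by auto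
    ultimately show "p \<in> ?L" by blast
  qed
  then show ?thesis unfolding S_reduct_def by simp
qed

lemma scliques_induced_reduct:
  assumes "R_structure M"
  shows "scliques (S_induced (S_reduct M) X) = (\<lambda>p. apexes M p \<inter> X) ` heavy M X"
proof -
  have "scliques (S_induced (S_reduct M) X)
      = {C \<inter> X | C. C \<in> apexes M ` heavy M UNIV \<and> size_ge3 (C \<inter> X)}"
    unfolding S_induced_def by (simp add: scliques_reduct[OF assms])
  also have "\<dots> = (\<lambda>p. apexes M p \<inter> X) ` heavy M X"
    unfolding heavy_def by (auto intro: size_ge3_mono)
  finally show ?thesis .
qed

text \<open>
  Pairs with different apex sets may acquire the same trace on \<open>X\<close>; the definition of the induced
  multiplicity adds up their contributions.
\<close>

lemma smult_induced_reduct: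
  assumes "R_structure M" "finite (heavy M X)" "size_ge3 C"
  shows "smult (S_induced (S_reduct M) X) C = card {p \<in> heavy M X. apexes M p \<inter> X = C}"
proof -
  let ?H = "{p \<in> heavy M X. apexes M p \<inter> X = C}"
  have L: "{L \<in> scliques (S_reduct M). L \<inter> X = C} = apexes M ` ?H"
    unfolding scliques_reduct[OF assms(1)] using assms(3) by (auto simp: heavy_def intro: size_ge3_mono)
  have "smult (S_induced (S_reduct M) X) C = (\<Sum>L\<in>apexes M ` ?H. smult (S_reduct M) L)"
    unfolding S_induced_def by (simp add: L)
  also have "\<dots> = (\<Sum>L\<in>apexes M ` ?H. \<Sum>p\<in>{p \<in> ?H. apexes M p = L}. 1)"
  proof (rule sum.cong)
    fix L assume "L \<in> apexes M ` ?H"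
    then have "{p. p \<subseteq> runiv M \<and> card p = 2 \<and> apexes M p = L} = {p \<in> ?H. apexes M p = L}"
      using assms(3) unfolding heavy_def by auto
    then show "smult (S_reduct M) L = (\<Sum>p\<in>{p \<in> ?H. apexes M p = L}. 1)"
      unfolding smult_reduct[OF assms(1)] by simp
  qed simp
  also have "\<dots> = (\<Sum>p\<in>?H. 1)" by (rule sum.group) (use assms(2) in auto)
  finally show ?thesis by simp
qed

text \<open>
  Translates any weighted sum over cliques, in particular the one in \<^const>\<open>d0s\<close>, into a sum over pairs.
\<close>

lemma sum_scliques_induced_reduct:
  assumes "R_structure M" "finite (heavy M X)"
  shows "(\<Sum>C\<in>scliques (S_induced (S_reduct M) X). smult (S_induced (S_reduct M) X) C * g C)
    = (\<Sum>p\<in>heavy M X. g (apexes M p \<inter> X))"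
proof -
  have "(\<Sum>C\<in>scliques (S_induced (S_reduct M) X). smult (S_induced (S_reduct M) X) C * g C)
    = (\<Sum>C\<in>(\<lambda>p. apexes M p \<inter> X) ` heavy M X.
         \<Sum>p\<in>{p \<in> heavy M X. apexes M p \<inter> X = C}. g (apexes M p \<inter> X))"
    unfolding scliques_induced_reduct[OF assms(1)]
    by (rule sum.cong) (auto simp: smult_induced_reduct[OF assms] heavy_def)
  also have "\<dots> = (\<Sum>p\<in>heavy M X. g (apexes M p \<inter> X))"
    by (rule sum.group) (use assms(2) in auto)
  finally show ?thesis .
qed

lemma int_excess: "size_ge3 C \<Longrightarrow> finite C \<Longrightarrow> int (card C) - 2 = int (card C - 2)"
  by (simp add: size_ge3_finite)

lemma d0s_eq:
  assumes "\<And>C. C \<in> scliques A \<Longrightarrow> finite C \<and> size_ge3 C"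
  shows "d0s A = int (card (suniv A)) - int (\<Sum>C\<in>scliques A. smult A C * (card C - 2))"
  unfolding d0s_def using assms by (simp add: int_excess)

lemma d0s_induced_reduct:
  assumes "R_structure M" "finite X" "finite (heavy M X)"
  shows "d0s (S_induced (S_reduct M) X)
    = int (card X) - int (\<Sum>p\<in>heavy M X. card (apexes M p \<inter> X) - 2)"
proof -
  have "d0s (S_induced (S_reduct M) X) = int (card X) -
     int (\<Sum>C\<in>scliques (S_induced (S_reduct M) X). smult (S_induced (S_reduct M) X) C * (card C - 2))"
    by (subst d0s_eq) (use assms(2) in \<open>auto simp: S_induced_def\<close>)
  then show ?thesis
    using sum_scliques_induced_reduct[OF assms(1,3), of "\<lambda>C. card C - 2"] by simp
qed

text \<open>
  Cliques with fewer than three points in \<open>Y\<close> disappear from the induced structure; truncated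
  subtraction gives them weight \<open>0\<close>, so the sum can run over the cliques of \<open>A\<close> itself.
\<close>

lemma d0s_induced:
  assumes "finite (scliques A)" "finite Y"
  shows "d0s (S_induced A Y)
    = int (card Y) - int (\<Sum>C\<in>scliques A. smult A C * (card (C \<inter> Y) - 2))"
proof -
  let ?H = "{C \<in> scliques A. size_ge3 (C \<inter> Y)}"
  have H: "scliques (S_induced A Y) = (\<lambda>C. C \<inter> Y) ` ?H" unfolding S_induced_def by auto
  have "(\<Sum>D\<in>scliques (S_induced A Y). smult (S_induced A Y) D * (card D - 2))
     = (\<Sum>D\<in>(\<lambda>C. C \<inter> Y) ` ?H. \<Sum>C\<in>{C \<in> ?H. C \<inter> Y = D}. smult A C * (card (C \<inter> Y) - 2))"
    unfolding H
  proof (rule sum.cong)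
    fix D assume "D \<in> (\<lambda>C. C \<inter> Y) ` ?H"
    then have "{C \<in> scliques A. C \<inter> Y = D} = {C \<in> ?H. C \<inter> Y = D}" by auto
    then show "smult (S_induced A Y) D * (card D - 2)
      = (\<Sum>C\<in>{C \<in> ?H. C \<inter> Y = D}. smult A C * (card (C \<inter> Y) - 2))"
      unfolding S_induced_def by (simp add: sum_distrib_right)
  qed simp
  also have "\<dots> = (\<Sum>C\<in>?H. smult A C * (card (C \<inter> Y) - 2))"
    by (rule sum.group) (use assms(1) in auto)
  also have "\<dots> = (\<Sum>C\<in>scliques A. smult A C * (card (C \<inter> Y) - 2))"
    by (rule sum.mono_neutral_left) (use assms in \<open>auto simp: size_ge3_finite\<close>)
  finally show ?thesis
    by (subst d0s_eq) (use assms(2) in \<open>auto simp: S_induced_def\<close>)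
qed

lemma S_strong_empty_iff:
  assumes "finite (scliques A)" "finite (suniv A)"
  shows "S_strong {} A \<longleftrightarrow>
    (\<forall>Y \<subseteq> suniv A. (\<Sum>C\<in>scliques A. smult A C * (card (C \<inter> Y) - 2)) \<le> card Y)"
  unfolding S_strong_def using assms(2)
  by (auto simp: d0s_induced[OF assms(1)] finite_subset simp del: of_nat_sum)

lemma S_structure_finite_scliques:
  assumes "S_structure A" "finite (suniv A)"
  shows "finite (scliques A)"
  by (rule finite_subset[of _ "Pow (suniv A)"]) (use assms in \<open>auto simp: S_structure_def\<close>)

text \<open>
  For \<open>Y \<subseteq> suniv A\<close> the clique sum over \<open>A\<close>, weighted by traces on \<open>Y\<close>, is transported to a sum
  over the pairs that are heavy over \<open>X\<close>, weighted by traces on the image of \<open>Y\<close>.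
\<close>

lemma S_strong_empty_if_iso_induced_reduct:
  assumes M: "R_structure M" "R_strong {} M"
    and A: "S_structure A" "finite (suniv A)"
    and X: "X \<subseteq> runiv M" "S_iso f A (S_induced (S_reduct M) X)"
  shows "S_strong {} A"
proof -
  let ?B = "S_induced (S_reduct M) X"
  note finC = S_structure_finite_scliques[OF A]
  have bij: "bij_betw f (suniv A) X" and cl: "(`) f ` scliques A = scliques ?B"
    and sm: "\<And>C. C \<in> scliques A \<Longrightarrow> smult ?B (f ` C) = smult A C"
    using X(2) unfolding S_iso_def by (auto simp: S_induced_def)
  have inj: "inj_on f (suniv A)" using bij by (rule bij_betw_imp_inj_on)
  have finX: "finite X" using bij_betw_finite[OF bij] A(2) by simp
  have finh: "finite (heavy M X)" by (rule finite_heavy[OF M finX X(1)])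
  have sub: "C \<subseteq> suniv A" if "C \<in> scliques A" for C using that A(1) unfolding S_structure_def by blast
  have "(\<Sum>C\<in>scliques A. smult A C * (card (C \<inter> Y) - 2)) \<le> card Y" if Y: "Y \<subseteq> suniv A" for Y
  proof -
    have fY: "f ` Y \<subseteq> X" using Y bij_betw_imp_surj_on[OF bij] by auto
    have injc: "inj_on ((`) f) (scliques A)"
      using inj_on_image_eq_iff[OF inj sub sub] by (intro inj_onI) simp
    have card: "card (f ` C \<inter> f ` Y) = card (C \<inter> Y)" if "C \<in> scliques A" for C
    proof -
      have "f ` C \<inter> f ` Y = f ` (C \<inter> Y)" using inj_on_image_Int[OF inj sub[OF that] Y] by simp
      moreover have "inj_on f (C \<inter> Y)" using inj Y by (meson inf_le2 inj_on_subset)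
      ultimately show ?thesis by (simp add: card_image)
    qed
    have "(\<Sum>C\<in>scliques A. smult A C * (card (C \<inter> Y) - 2))
      = (\<Sum>C\<in>scliques ?B. smult ?B C * (card (C \<inter> f ` Y) - 2))"
      unfolding cl[symmetric] sum.reindex[OF injc] by (rule sum.cong) (auto simp: sm card)
    also have "\<dots> = (\<Sum>p\<in>heavy M X. card (apexes M p \<inter> X \<inter> f ` Y) - 2)"
      by (rule sum_scliques_induced_reduct[OF M(1) finh])
    also have "\<dots> = (\<Sum>p\<in>heavy M X. card (apexes M p \<inter> f ` Y) - 2)"
      using fY by (simp add: Int_assoc inf.absorb2)
    also have "\<dots> \<le> card (f ` Y)"
    proof (rule sum_heavy_le[OF M _ _ finh])
      show "finite (f ` Y)" using fY finX by (rule finite_subset)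
      show "f ` Y \<subseteq> runiv M" using fY X(1) by (rule subset_trans)
    qed (simp add: heavy_def)
    also have "\<dots> = card Y" by (rule card_image[OF inj_on_subset[OF inj Y]])
    finally show ?thesis .
  qed
  then show ?thesis using S_strong_empty_iff[OF finC A(2)] by blast
qed

section \<open>Realising an S-structure by hinges\<close>

definition hinge :: "'b set \<times> nat \<Rightarrow> ('b + ('b set \<times> nat) \<times> bool) set" where
  "hinge q = {Inr (q, True), Inr (q, False)}"

text \<open>
  A slot is one of the copies of a clique demanded by its multiplicity; each slot gets its own hinge.
\<close>

definition slots :: "'b sstr \<Rightarrow> ('b set \<times> nat) set" where
  "slots A = (SIGMA C:scliques A. {..<smult A C})"

definition hinge_expansion :: "'b sstr \<Rightarrow> ('b + ('b set \<times> nat) \<times> bool) rstr" where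
  "hinge_expansion A =
     \<lparr>runiv = Inl ` suniv A \<union> (\<Union>q\<in>slots A. hinge q),
      rrel = (\<lambda>x y z. \<exists>q\<in>slots A. \<exists>c\<in>fst q. {x, y, z} = insert (Inl c) (hinge q))\<rparr>"

lemma finite_hinge: "finite (hinge q)"
  and card_hinge: "card (hinge q) = 2"
  and Inl_notin_hinge: "Inl c \<notin> hinge q"
  unfolding hinge_def by auto

lemma hinge_disjoint: "x \<in> hinge q \<Longrightarrow> x \<in> hinge r \<Longrightarrow> q = r"
  unfolding hinge_def by auto

lemma hinge_inj:
  assumes "hinge q = hinge r"
  shows "q = r"
proof (rule hinge_disjoint)
  show "Inr (q, True) \<in> hinge q" by (simp add: hinge_def)
  then show "Inr (q, True) \<in> hinge r" unfolding assms .
qed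

lemma slots_clique: "q \<in> slots A \<Longrightarrow> fst q \<in> scliques A"
  unfolding slots_def by auto

lemma finite_slots:
  assumes "S_structure A" "finite (suniv A)"
  shows "finite (slots A)"
  unfolding slots_def using S_structure_finite_scliques[OF assms] by auto

lemma edges_hinge_expansion:
  "edges (hinge_expansion A) = {insert (Inl c) (hinge q) | c q. q \<in> slots A \<and> c \<in> fst q}"
proof (intro equalityI subsetI)
  fix T assume "T \<in> edges (hinge_expansion A)"
  then obtain x y z where "T = {x, y, z}" "rrel (hinge_expansion A) x y z" unfolding edges_def by blast
  then have "\<exists>q\<in>slots A. \<exists>c\<in>fst q. T = insert (Inl c) (hinge q)"
    unfolding hinge_expansion_def by simp
  then show "T \<in> {insert (Inl c) (hinge q) | c q. q \<in> slots A \<and> c \<in> fst q}" by blast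
next
  fix T assume "T \<in> {insert (Inl c) (hinge q) | c q. q \<in> slots A \<and> c \<in> fst q}"
  then obtain c q where q: "q \<in> slots A" "c \<in> fst q" and T: "T = insert (Inl c) (hinge q)" by blast
  have eq: "{Inl c, Inr (q, True), Inr (q, False)} = insert (Inl c) (hinge q)"
    unfolding hinge_def ..
  then have "rrel (hinge_expansion A) (Inl c) (Inr (q, True)) (Inr (q, False))"
    unfolding hinge_expansion_def using q by (simp, intro bexI[of _ q] bexI[of _ c]) simp_all
  moreover have "T = {Inl c, Inr (q, True), Inr (q, False)}" unfolding T eq ..
  ultimately show "T \<in> edges (hinge_expansion A)" unfolding edges_def by blast
qed

lemma R_structure_hinge_expansion:
  assumes "S_structure A"
  shows "R_structure (hinge_expansion A)"
  unfolding R_structure_def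
proof (intro allI impI)
  fix x y z
  assume r: "rrel (hinge_expansion A) x y z"
  then have "\<exists>q\<in>slots A. \<exists>c\<in>fst q. {x, y, z} = insert (Inl c) (hinge q)"
    unfolding hinge_expansion_def by simp
  then obtain q c where q: "q \<in> slots A" "c \<in> fst q" and T: "{x, y, z} = insert (Inl c) (hinge q)"
    by blast
  have "c \<in> suniv A" using slots_clique[OF q(1)] q(2) assms unfolding S_structure_def by blast
  then have "{x, y, z} \<subseteq> runiv (hinge_expansion A)"
    unfolding T hinge_expansion_def using q(1) by auto
  moreover have "card {x, y, z} = 3"
    unfolding T by (simp add: finite_hinge card_hinge Inl_notin_hinge)
  then have "x \<noteq> y \<and> x \<noteq> z \<and> y \<noteq> z" by (auto simp: card_insert_if split: if_splits)
  moreover have "rrel (hinge_expansion A) u v w" if "{u, v, w} = {x, y, z}" for u v w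
    using r that unfolding hinge_expansion_def by simp
  from this[of y x z] this[of x z y]
  have "rrel (hinge_expansion A) y x z \<and> rrel (hinge_expansion A) x z y" by blast
  ultimately show "x \<in> runiv (hinge_expansion A) \<and> y \<in> runiv (hinge_expansion A) \<and>
    z \<in> runiv (hinge_expansion A) \<and> x \<noteq> y \<and> x \<noteq> z \<and> y \<noteq> z \<and>
    rrel (hinge_expansion A) y x z \<and> rrel (hinge_expansion A) x z y" by simp
qed

text \<open>
  For a set \<open>Y\<close> of points of the expansion, with trace \<open>Z\<close> on \<open>A\<close>, only hinges contained in \<open>Y\<close>
  carry edges in \<open>Y\<close>.  Such a hinge carries at most \<open>(|C \<inter> Z| - 2) + 2\<close> edges: its own two
  points pay for the summand \<open>2\<close>, and by \<open>{} \<le> A\<close> the points of \<open>Z\<close> pay for the rest.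
\<close>

lemma hinge_expansion_in_class_C:
  assumes A: "S_structure A" "finite (suniv A)" and st: "S_strong {} A"
  shows "hinge_expansion A \<in> class_C"
proof -
  let ?B = "hinge_expansion A"
  note finC = S_structure_finite_scliques[OF A] and finS = finite_slots[OF A]
  have finB: "finite (runiv ?B)"
    unfolding hinge_expansion_def using A(2) finS finite_hinge by auto
  have "card (edges ?B \<inter> Pow Y) \<le> card Y" if Y: "Y \<subseteq> runiv ?B" for Y
  proof -
    define Z where "Z = {c \<in> suniv A. Inl c \<in> Y}"
    define Q where "Q = {q \<in> slots A. hinge q \<subseteq> Y}"
    have finY: "finite Y" using Y finB by (rule finite_subset)
    have finZ: "finite Z" unfolding Z_def using A(2) by simp
    have finQ: "finite Q" unfolding Q_def using finS by simp
    have sub: "fst q \<subseteq> suniv A" if "q \<in> slots A" for q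
      using slots_clique[OF that] A(1) unfolding S_structure_def by blast
    have "edges ?B \<inter> Pow Y \<subseteq> (\<Union>q\<in>Q. (\<lambda>c. insert (Inl c) (hinge q)) ` (fst q \<inter> Z))"
      unfolding edges_hinge_expansion Q_def Z_def using sub by fastforce
    then have "card (edges ?B \<inter> Pow Y) \<le> card (\<Union>q\<in>Q. (\<lambda>c. insert (Inl c) (hinge q)) ` (fst q \<inter> Z))"
      by (rule card_mono[rotated]) (use finQ finZ in auto)
    also have "\<dots> \<le> (\<Sum>q\<in>Q. card ((\<lambda>c. insert (Inl c) (hinge q)) ` (fst q \<inter> Z)))"
      by (rule card_UN_le[OF finQ])
    also have "\<dots> \<le> (\<Sum>q\<in>Q. (card (fst q \<inter> Z) - 2) + 2)"
    proof (rule sum_mono)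
      fix q
      have "card ((\<lambda>c. insert (Inl c) (hinge q)) ` (fst q \<inter> Z)) \<le> card (fst q \<inter> Z)"
        by (rule card_image_le) (use finZ in simp)
      then show "card ((\<lambda>c. insert (Inl c) (hinge q)) ` (fst q \<inter> Z)) \<le> (card (fst q \<inter> Z) - 2) + 2"
        by simp
    qed
    also have "\<dots> = (\<Sum>q\<in>Q. card (fst q \<inter> Z) - 2) + (\<Sum>q\<in>Q. 2)" by (rule sum.distrib)
    also have "(\<Sum>q\<in>Q. card (fst q \<inter> Z) - 2) \<le> card Z"
    proof -
      have "(\<Sum>q\<in>Q. card (fst q \<inter> Z) - 2) \<le> (\<Sum>q\<in>slots A. card (fst q \<inter> Z) - 2)"
        by (rule sum_mono2) (use finS in \<open>auto simp: Q_def\<close>)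
      also have "\<dots> = (\<Sum>C\<in>scliques A. \<Sum>i<smult A C. card (C \<inter> Z) - 2)"
        unfolding slots_def using finC by (subst sum.Sigma) (auto simp: case_prod_unfold)
      also have "\<dots> = (\<Sum>C\<in>scliques A. smult A C * (card (C \<inter> Z) - 2))" by simp
      also have "\<dots> \<le> card Z"
        using st[unfolded S_strong_empty_iff[OF finC A(2)], rule_format, of Z] unfolding Z_def by simp
      finally show ?thesis .
    qed
    also have "card Z + (\<Sum>q\<in>Q. 2) = card (Inl ` Z \<union> (\<Union>q\<in>Q. hinge q))"
    proof -
      have "card (\<Union>q\<in>Q. hinge q) = (\<Sum>q\<in>Q. card (hinge q))"
        by (rule card_UN_disjoint[OF finQ]) (use finite_hinge hinge_disjoint in blast)+
      moreover have "Inl ` Z \<inter> (\<Union>q\<in>Q. hinge q) = {}" by (auto simp: Inl_notin_hinge)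
      moreover have "card (Inl ` Z :: ('a + ('a set \<times> nat) \<times> bool) set) = card Z" by (simp add: card_image)
      ultimately show ?thesis
        using finZ finQ finite_hinge by (subst card_Un_disjoint) (auto simp: card_hinge)
    qed
    also have "\<dots> \<le> card Y" by (rule card_mono[OF finY]) (auto simp: Z_def Q_def)
    finally show ?thesis by simp
  qed
  then show ?thesis
    unfolding class_C_def using R_structure_hinge_expansion[OF A(1)] finB R_strong_empty_iff by blast
qed

lemma apexes_hinge:
  fixes A :: "'b sstr"
  assumes "q \<in> slots A"
  shows "apexes (hinge_expansion A) (hinge q) = Inl ` fst q"
proof (intro equalityI subsetI)
  fix x assume "x \<in> apexes (hinge_expansion A) (hinge q)"
  then obtain c r where x: "x \<notin> hinge q" and r: "c \<in> fst r" "insert x (hinge q) = insert (Inl c) (hinge r)"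
    unfolding apexes_def edges_hinge_expansion by blast
  have "Inr (q, True) \<in> insert (Inl c) (hinge r)" unfolding r(2)[symmetric] by (simp add: hinge_def)
  then have "Inr (q, True) \<in> hinge r" by simp
  moreover have "Inr (q, True) \<in> hinge q" unfolding hinge_def by simp
  ultimately have "q = r" by (rule hinge_disjoint[symmetric])
  then have "insert x (hinge q) = insert (Inl c) (hinge q)" using r(2) by simp
  then have "x = Inl c" using x by blast
  then show "x \<in> Inl ` fst q" using r(1) \<open>q = r\<close> by simp
next
  fix x :: "'b + ('b set \<times> nat) \<times> bool"
  assume "x \<in> Inl ` fst q"
  then obtain c where c: "x = Inl c" "c \<in> fst q" ..
  then have "insert x (hinge q) \<in> edges (hinge_expansion A)"
    unfolding edges_hinge_expansion using assms by blast
  then show "x \<in> apexes (hinge_expansion A) (hinge q)"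
    unfolding apexes_def c(1) by (simp add: Inl_notin_hinge)
qed

text \<open>
  A pair other than a hinge that lies in an edge consists of a point \<open>a\<close> of \<open>A\<close> and a point of some
  hinge.  These determine the edge, whose third point is then the only apex.
\<close>

lemma hinge_if_two_apexes:
  assumes p: "card p = 2" and c: "2 \<le> card (apexes (hinge_expansion A) p)"
  shows "\<exists>q\<in>slots A. p = hinge q"
proof (rule ccontr)
  assume no: "\<not> ?thesis"
  have finp: "finite p" using p by (simp add: card_ge_0_finite)
  have "finite (apexes (hinge_expansion A) p)" using c by (intro card_ge_0_finite) simp
  then obtain x y where xy: "x \<in> apexes (hinge_expansion A) p" "y \<in> apexes (hinge_expansion A) p" "x \<noteq> y"
    using c card_le_Suc0_iff_eq[of "apexes (hinge_expansion A) p"] by fastforce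
  obtain a q where q: "q \<in> slots A" "insert x p = insert (Inl a) (hinge q)" "x \<notin> p"
    using xy(1) unfolding apexes_def edges_hinge_expansion by blast
  obtain b r where r: "r \<in> slots A" "insert y p = insert (Inl b) (hinge r)" "y \<notin> p"
    using xy(2) unfolding apexes_def edges_hinge_expansion by blast
  have split: "Inl d \<in> p \<and> (\<exists>u \<in> p. u \<in> hinge s)"
    if s: "s \<in> slots A" "insert z p = insert (Inl d) (hinge s)" "z \<notin> p" for z d s
  proof -
    have "p \<noteq> hinge s" using no s(1) by blast
    moreover have "p = hinge s" if "p \<subseteq> hinge s"
      by (rule card_subset_eq[OF finite_hinge that]) (simp add: p card_hinge)
    ultimately have "\<not> p \<subseteq> hinge s" by blast
    moreover have ps: "p \<subseteq> insert (Inl d) (hinge s)" unfolding s(2)[symmetric] by (rule subset_insertI)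
    ultimately have d: "Inl d \<in> p" by blast
    have "\<not> p \<subseteq> {Inl d}"
    proof
      assume "p \<subseteq> {Inl d}"
      then have "card p \<le> card {Inl d :: 'a + ('a set \<times> nat) \<times> bool}" by (intro card_mono) auto
      then show False using p by simp
    qed
    then show ?thesis using d ps by blast
  qed
  obtain u where u: "Inl a \<in> p" "u \<in> p" "u \<in> hinge q" using split[OF q] by blast
  have "Inl b \<in> p" using split[OF r] by blast
  then have "Inl b \<in> insert (Inl a) (hinge q)" using q(2) by blast
  then have ab: "b = a" by (simp add: Inl_notin_hinge)
  have "u \<in> insert (Inl b) (hinge r)" using u(2) r(2) by auto
  moreover have "u \<noteq> Inl b" using u(3) by (auto simp: Inl_notin_hinge)
  ultimately have "u \<in> hinge r" by simp
  then have "q = r" by (rule hinge_disjoint[OF u(3)])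
  then have "insert x p = insert y p" using ab q(2) r(2) by simp
  then have "x \<in> insert y p" using insertI1[of x p] by simp
  then show False using xy(3) q(3) by simp
qed

section \<open>Embedding into the generic structure\<close>

lemma R_generic_strong_empty:
  assumes "R_generic M"
  shows "R_structure M" "R_strong {} M"
proof -
  show M: "R_structure M" using assms unfolding R_generic_def by blast
  show "R_strong {} M"
    unfolding R_strong_empty_iff[OF M]
  proof (intro allI impI)
    fix Y assume Y: "finite Y \<and> Y \<subseteq> runiv M"
    then have C: "R_induced M Y \<in> class_C" using assms unfolding R_generic_def by blast
    then have "card (edges (R_induced M Y) \<inter> Pow Y) \<le> card Y"
      using Y R_strong_empty_iff[of "R_induced M Y"] unfolding class_C_def by (simp add: R_induced_def)
    moreover have "edges M \<inter> Pow Y \<subseteq> edges (R_induced M Y) \<inter> Pow Y"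
      unfolding edges_def R_induced_def by auto
    then have "card (edges M \<inter> Pow Y) \<le> card (edges (R_induced M Y) \<inter> Pow Y)"
      using Y by (intro card_mono) auto
    ultimately show "card (edges M \<inter> Pow Y) \<le> card Y" by simp
  qed
qed

text \<open>
  The extension property over the empty set, for structures on an arbitrary type: a finite structure
  is first copied to the natural numbers.
\<close>

lemma R_generic_strong_embedding:
  fixes M :: "'a rstr" and B :: "'c rstr"
  assumes M: "R_generic M" and B: "B \<in> class_C"
  obtains e where "R_embedding e B M" "R_strong (e ` runiv B) M"
proof -
  have RB: "R_structure B" and finB: "finite (runiv B)" and sB: "R_strong {} B"
    using B unfolding class_C_def by auto
  obtain h :: "'c \<Rightarrow> nat" where h: "inj_on h (runiv B)"
    using finite_imp_inj_to_nat_seg[OF finB] by blast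
  define B' where "B' = \<lparr>runiv = h ` runiv B,
    rrel = (\<lambda>x y z. \<exists>a b c. x = h a \<and> y = h b \<and> z = h c \<and> rrel B a b c)\<rparr>"
  have inB: "a \<in> runiv B \<and> b \<in> runiv B \<and> c \<in> runiv B \<and> a \<noteq> b \<and> a \<noteq> c \<and> b \<noteq> c \<and> rrel B b a c \<and> rrel B a c b"
    if "rrel B a b c" for a b c
    using RB that unfolding R_structure_def by blast
  have univ: "runiv B' = h ` runiv B" unfolding B'_def by simp
  have rel: "rrel B' (h a) (h b) (h c) \<longleftrightarrow> rrel B a b c"
    if "a \<in> runiv B" "b \<in> runiv B" "c \<in> runiv B" for a b c
  proof
    assume "rrel B' (h a) (h b) (h c)"
    then obtain a' b' c' where r: "h a = h a'" "h b = h b'" "h c = h c'" "rrel B a' b' c'"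
      unfolding B'_def by auto
    then have "a = a'" "b = b'" "c = c'" using inB[OF r(4)] that inj_onD[OF h] by blast+
    then show "rrel B a b c" using r(4) by simp
  qed (auto simp: B'_def)
  have RB': "R_structure B'"
    unfolding R_structure_def
  proof (intro allI impI)
    fix x y z assume "rrel B' x y z"
    then obtain a b c where eq: "x = h a" "y = h b" "z = h c" and r: "rrel B a b c"
      unfolding B'_def by auto
    note i = inB[OF r]
    show "x \<in> runiv B' \<and> y \<in> runiv B' \<and> z \<in> runiv B' \<and> x \<noteq> y \<and> x \<noteq> z \<and> y \<noteq> z \<and>
      rrel B' y x z \<and> rrel B' x z y"
      unfolding eq using i rel univ by (auto simp: inj_on_eq_iff[OF h])
  qed
  have emb: "R_embedding h B B'"
    unfolding R_embedding_def using h rel univ by auto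
  have sB': "R_strong {} B'"
    unfolding R_strong_empty_iff[OF RB']
  proof (intro allI impI)
    fix Y assume Y: "finite Y \<and> Y \<subseteq> runiv B'"
    then obtain Z where Z: "Z \<subseteq> runiv B" "Y = h ` Z" unfolding univ by (auto simp: subset_image_iff)
    have finZ: "finite Z" using Z(1) finB by (rule finite_subset)
    have "card (edges B' \<inter> Pow Y) \<le> card (edges B \<inter> Pow Z)"
      unfolding Z(2) edges_image[OF RB RB' emb Z(1)] by (rule card_image_le) (use finZ in simp)
    also have "\<dots> \<le> card Z" using sB finZ Z(1) R_strong_empty_iff[OF RB] by blast
    also have "\<dots> = card Y" unfolding Z(2) using inj_on_subset[OF h Z(1)] by (simp add: card_image)
    finally show "card (edges B' \<inter> Pow Y) \<le> card Y" .
  qed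
  have C: "B' \<in> class_C" unfolding class_C_def using RB' sB' finB univ by simp
  have "R_strong {} M" by (rule R_generic_strong_empty(2)[OF M])
  moreover have "R_embedding (\<lambda>_. 0) (R_induced M {}) B'" unfolding R_embedding_def R_induced_def by simp
  moreover have "R_strong ((\<lambda>_ :: 'a. 0) ` {}) B'" using sB' by simp
  ultimately have "\<exists>f. R_embedding f B' M \<and> (\<forall>x\<in>{}. f ((\<lambda>_ :: 'a. 0) x) = x) \<and> R_strong (f ` runiv B') M"
    using C by (intro M[unfolded R_generic_def, THEN conjunct2, THEN conjunct2, THEN conjunct2, THEN spec,
        THEN spec, THEN spec, THEN mp]) simp
  then obtain f where "R_embedding f B' M \<and> (\<forall>x\<in>{}. f ((\<lambda>_ :: 'a. 0) x) = x) \<and> R_strong (f ` runiv B') M" ..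
  then have f: "R_embedding f B' M" "R_strong (f ` runiv B') M" by simp_all
  have injf: "inj_on f (h ` runiv B)" and fM: "f ` h ` runiv B \<subseteq> runiv M"
    and frel: "\<forall>x\<in>h ` runiv B. \<forall>y\<in>h ` runiv B. \<forall>z\<in>h ` runiv B. rrel B' x y z \<longleftrightarrow> rrel M (f x) (f y) (f z)"
    using f(1) unfolding R_embedding_def univ by simp_all
  have "R_embedding (f \<circ> h) B M"
    unfolding R_embedding_def
  proof (intro conjI ballI)
    show "inj_on (f \<circ> h) (runiv B)" by (rule comp_inj_on[OF h injf])
    show "(f \<circ> h) ` runiv B \<subseteq> runiv M" using fM by (simp add: image_comp)
    show "rrel B x y z \<longleftrightarrow> rrel M ((f \<circ> h) x) ((f \<circ> h) y) ((f \<circ> h) z)"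
      if "x \<in> runiv B" "y \<in> runiv B" "z \<in> runiv B" for x y z
      using frel[rule_format, OF imageI imageI imageI, OF that] rel[OF that] by simp
  qed
  moreover have "R_strong ((f \<circ> h) ` runiv B) M" using f(2) unfolding univ by (simp add: image_comp)
  ultimately show ?thesis by (rule that)
qed

text \<open>
  Otherwise adding at most two new points to the strong set \<open>B\<close> would create at least three new edges.
  Formally this is the central estimate for the single pair \<open>p\<close> and \<open>D = B\<close>.
\<close>

lemma pair_subset_strong:
  assumes N: "R_structure N" and B: "R_strong B N"
    and p: "p \<subseteq> runiv N" "card p = 2" and c: "3 \<le> card (apexes N p \<inter> B)"
  shows "p \<subseteq> B"
proof (rule ccontr)
  assume "\<not> p \<subseteq> B"
  then have e: "{p' \<in> {p}. p' \<subseteq> B} = {}" by blast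
  have "finite B" "B \<subseteq> runiv N" using B unfolding R_strong_def by auto
  then have "(\<Sum>p'\<in>{p}. int (card (apexes N p' \<inter> B)) - 2)
    \<le> int (card (B - B)) + (\<Sum>p'\<in>{p' \<in> {p}. p' \<subseteq> B}. int (card (apexes N p' \<inter> (B \<inter> B))) - 2)"
    using p by (intro sum_apexes_le[OF N B]) auto
  then show False unfolding e using c by simp
qed

text \<open>
  The heavy pairs over the image \<open>X\<close> of \<open>A\<close> are exactly the images of the hinges, and the apex set of
  each of them meets the image \<open>B\<close> of the whole expansion in the image of its clique.  The first fact
  identifies the induced structure.  For strength over \<open>D \<supseteq> X\<close>, the central estimate leaves the points of
  \<open>D - B\<close> and the heavy pairs inside \<open>B\<close>, whose contribution is at most that of the hinges.
\<close>

lemma S_strong_embedding_if_hinge_expansion_strong: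
  assumes M: "R_structure M" "R_strong {} M"
    and A: "S_structure A" "finite (suniv A)"
    and e: "R_embedding e (hinge_expansion A) M"
    and strong: "R_strong (e ` runiv (hinge_expansion A)) M"
  shows "S_strong_embedding (e \<circ> Inl) A (S_reduct M)"
proof -
  define V where "V = runiv (hinge_expansion A)"
  define B where "B = e ` V"
  define F where "F = e \<circ> Inl"
  define X where "X = F ` suniv A"
  define H where "H = (\<lambda>q. e ` hinge q) ` slots A"
  let ?S = "S_reduct M"
  note RE = R_structure_hinge_expansion[OF A(1)]
  have finV: "finite V"
    unfolding V_def hinge_expansion_def using A(2) finite_slots[OF A] finite_hinge by auto
  have injV: "inj_on e V" using e unfolding R_embedding_def V_def by blast
  have BM: "B \<subseteq> runiv M" using e unfolding R_embedding_def V_def B_def by blast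
  have finB: "finite B" unfolding B_def using finV by simp
  have strongB: "R_strong B M" using strong unfolding B_def V_def .
  have Inl_V: "Inl ` suniv A \<subseteq> V" unfolding V_def hinge_expansion_def by simp
  have hinge_V: "hinge q \<subseteq> V" if "q \<in> slots A" for q
    using that unfolding V_def hinge_expansion_def by auto
  have XB: "X \<subseteq> B" unfolding X_def B_def F_def using Inl_V by auto
  have finX: "finite X" using XB finB by (rule finite_subset)
  have XM: "X \<subseteq> runiv M" using XB BM by (rule subset_trans)
  have injF: "inj_on F (suniv A)"
    unfolding F_def by (rule comp_inj_on) (use inj_on_subset[OF injV Inl_V] in auto)
  have clique: "C \<subseteq> suniv A" "size_ge3 C" "0 < smult A C" if "C \<in> scliques A" for C
    using that A(1) unfolding S_structure_def by auto
  have FC: "F ` C \<subseteq> X" "size_ge3 (F ` C)" if C: "C \<in> scliques A" for C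
  proof -
    show "F ` C \<subseteq> X" unfolding X_def using clique(1)[OF C] by (rule image_mono)
    have "finite C" using clique(1)[OF C] A(2) by (rule finite_subset)
    moreover have "card (F ` C) = card C" by (rule card_image[OF inj_on_subset[OF injF clique(1)[OF C]]])
    ultimately show "size_ge3 (F ` C)" using clique(2)[OF C] by (simp add: size_ge3_finite)
  qed
  have apB: "apexes M (e ` hinge q) \<inter> B = F ` fst q" if q: "q \<in> slots A" for q
    using apexes_image[OF RE M(1) e hinge_V[OF q, unfolded V_def]]
    unfolding B_def V_def apexes_hinge[OF q] F_def by (simp add: image_comp)
  have apX: "apexes M (e ` hinge q) \<inter> X = F ` fst q" if q: "q \<in> slots A" for q
    using apB[OF q] XB FC(1)[OF slots_clique[OF q]] by blast
  have in_H: "p \<in> H" if p: "p \<subseteq> B" "card p = 2" "2 \<le> card (apexes M p \<inter> B)" for p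
  proof -
    obtain p0 where p0: "p0 \<subseteq> V" "p = e ` p0" using p(1) unfolding B_def by (auto simp: subset_image_iff)
    have "card p0 = 2" using p(2) inj_on_subset[OF injV p0(1)] unfolding p0(2) by (simp add: card_image)
    moreover have "card (apexes M p \<inter> B) \<le> card (apexes (hinge_expansion A) p0)"
      unfolding p0(2) B_def V_def apexes_image[OF RE M(1) e p0(1)[unfolded V_def]]
      by (rule card_image_le)
        (use finite_subset[OF apexes_subset[OF RE] finV[unfolded V_def]] in blast)
    then have "2 \<le> card (apexes (hinge_expansion A) p0)" using p(3) by simp
    ultimately obtain q where "q \<in> slots A" "p0 = hinge q" using hinge_if_two_apexes by blast
    then show ?thesis unfolding H_def p0(2) by blast
  qed
  have heavy_X: "heavy M X = H"
  proof (intro equalityI subsetI)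
    fix p assume p: "p \<in> heavy M X"
    have "card (apexes M p \<inter> X) \<le> card (apexes M p \<inter> B)"
      using XB finB by (intro card_mono) auto
    then have 3: "3 \<le> card (apexes M p \<inter> B)"
      using p finX unfolding heavy_def by (simp add: size_ge3_finite)
    have "p \<subseteq> B" by (rule pair_subset_strong[OF M(1) strongB _ _ 3]) (use p in \<open>auto simp: heavy_def\<close>)
    then show "p \<in> H" by (rule in_H) (use p 3 in \<open>auto simp: heavy_def\<close>)
  next
    fix p assume "p \<in> H"
    then obtain q where q: "q \<in> slots A" "p = e ` hinge q" unfolding H_def by blast
    have "p \<subseteq> B" unfolding q(2) B_def using hinge_V[OF q(1)] by (rule image_mono)
    moreover have "card p = 2"
      unfolding q(2) using inj_on_subset[OF injV hinge_V[OF q(1)]] by (simp add: card_image card_hinge)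
    moreover have "size_ge3 (apexes M p \<inter> X)"
      unfolding q(2) apX[OF q(1)] by (rule FC(2)[OF slots_clique[OF q(1)]])
    ultimately show "p \<in> heavy M X" using BM unfolding heavy_def by blast
  qed
  have finH: "finite H" unfolding H_def using finite_slots[OF A] by simp
  have injH: "inj_on (\<lambda>q. e ` hinge q) (slots A)"
  proof (rule inj_onI)
    fix q r assume qr: "q \<in> slots A" "r \<in> slots A" "e ` hinge q = e ` hinge r"
    then have "hinge q = hinge r" using inj_on_image_eq_iff[OF injV hinge_V hinge_V] by blast
    then show "q = r" by (rule hinge_inj)
  qed

  have iso: "S_iso F A (S_induced ?S X)"
    unfolding S_iso_def
  proof (intro conjI ballI)
    show "bij_betw F (suniv A) (suniv (S_induced ?S X))"
      using injF unfolding bij_betw_def S_induced_def X_def by simp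
    have "scliques (S_induced ?S X) = (\<lambda>q. F ` fst q) ` slots A"
      unfolding scliques_induced_reduct[OF M(1)] heavy_X H_def image_image
      by (rule image_cong) (simp_all add: apX)
    also have "\<dots> = (`) F ` fst ` slots A" by (simp add: image_image)
    also have "fst ` slots A = scliques A"
      unfolding slots_def using clique(3) by (force simp: image_iff)
    finally show "(`) F ` scliques A = scliques (S_induced ?S X)" ..
    fix C assume C: "C \<in> scliques A"
    have "{p \<in> H. apexes M p \<inter> X = F ` C} = (\<lambda>q. e ` hinge q) ` ({C} \<times> {..<smult A C})"
    proof (intro equalityI subsetI)
      fix p assume "p \<in> {p \<in> H. apexes M p \<inter> X = F ` C}"
      then obtain q where q: "q \<in> slots A" "p = e ` hinge q" "F ` fst q = F ` C"
        unfolding H_def using apX by auto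
      have "fst q = C"
        using q(3) inj_on_image_eq_iff[OF injF clique(1)[OF slots_clique[OF q(1)]] clique(1)[OF C]] by simp
      then have "q \<in> {C} \<times> {..<smult A C}" using q(1) unfolding slots_def by auto
      then show "p \<in> (\<lambda>q. e ` hinge q) ` ({C} \<times> {..<smult A C})" unfolding q(2) by (rule imageI)
    next
      fix p assume "p \<in> (\<lambda>q. e ` hinge q) ` ({C} \<times> {..<smult A C})"
      then obtain q where q: "q \<in> {C} \<times> {..<smult A C}" "p = e ` hinge q" by blast
      then have "q \<in> slots A" "fst q = C" unfolding slots_def using C by auto
      then show "p \<in> {p \<in> H. apexes M p \<inter> X = F ` C}" unfolding q(2) H_def using apX by auto
    qed
    moreover have "inj_on (\<lambda>q. e ` hinge q) ({C} \<times> {..<smult A C})"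
      by (rule inj_on_subset[OF injH]) (use C in \<open>auto simp: slots_def\<close>)
    ultimately have "card {p \<in> H. apexes M p \<inter> X = F ` C} = smult A C"
      by (simp add: card_image)
    then show "smult (S_induced ?S X) (F ` C) = smult A C"
      using smult_induced_reduct[OF M(1) _ FC(2)[OF C], of X] finH unfolding heavy_X by simp
  qed

  have "d0s (S_induced ?S X) \<le> d0s (S_induced ?S D)"
    if D: "finite D" "X \<subseteq> D" "D \<subseteq> runiv M" for D
  proof -
    let ?K = "{p \<in> heavy M D. p \<subseteq> B}"
    have finh: "finite (heavy M D)" by (rule finite_heavy[OF M D(1,3)])
    have "int (\<Sum>p\<in>heavy M D. card (apexes M p \<inter> D) - 2)
      = (\<Sum>p\<in>heavy M D. int (card (apexes M p \<inter> D)) - 2)"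
      unfolding of_nat_sum
      by (rule sum.cong) (use D(1) in \<open>auto simp: heavy_def size_ge3_finite\<close>)
    also have "\<dots> \<le> int (card (D - B)) + (\<Sum>p\<in>?K. int (card (apexes M p \<inter> (D \<inter> B))) - 2)"
      by (rule sum_apexes_le[OF M(1) strongB D(1,3) finh]) (simp add: heavy_def)
    also have "(\<Sum>p\<in>?K. int (card (apexes M p \<inter> (D \<inter> B))) - 2)
      \<le> (\<Sum>p\<in>?K. int (card (apexes M p \<inter> B) - 2))"
    proof (rule sum_mono)
      fix p
      have "card (apexes M p \<inter> (D \<inter> B)) \<le> card (apexes M p \<inter> B)"
        using finB by (intro card_mono) auto
      then show "int (card (apexes M p \<inter> (D \<inter> B))) - 2 \<le> int (card (apexes M p \<inter> B) - 2)" by simp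
    qed
    also have "\<dots> \<le> (\<Sum>p\<in>?K \<union> H. int (card (apexes M p \<inter> B) - 2))"
      by (rule sum_mono2) (use finh finH in auto)
    also have "\<dots> = (\<Sum>p\<in>H. int (card (apexes M p \<inter> B) - 2))"
    proof (rule sum.mono_neutral_right)
      show "\<forall>p\<in>?K \<union> H - H. int (card (apexes M p \<inter> B) - 2) = 0"
      proof
        fix p assume p: "p \<in> ?K \<union> H - H"
        \<comment> \<open>A pair inside \<open>B\<close> that is not a hinge has at most one apex in \<open>B\<close>.\<close>
        then have "\<not> 2 \<le> card (apexes M p \<inter> B)" using in_H[of p] unfolding heavy_def by blast
        then show "int (card (apexes M p \<inter> B) - 2) = 0" by simp
      qed
    qed (use finh finH in auto)
    also have "\<dots> = (\<Sum>p\<in>H. int (card (apexes M p \<inter> X) - 2))"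
      by (rule sum.cong) (auto simp: H_def apB apX)
    also have "\<dots> = int (\<Sum>p\<in>heavy M X. card (apexes M p \<inter> X) - 2)"
      unfolding heavy_X by simp
    finally have main: "int (\<Sum>p\<in>heavy M D. card (apexes M p \<inter> D) - 2)
      \<le> int (card (D - B)) + int (\<Sum>p\<in>heavy M X. card (apexes M p \<inter> X) - 2)" by simp
    \<comment> \<open>\<open>D\<close> may contain points of hinges, so its part in \<open>B\<close> can exceed \<open>X\<close>; this only helps.\<close>
    have "card (D - B) + card X = card ((D - B) \<union> X)"
      using D(1) finX XB by (subst card_Un_disjoint) auto
    also have "\<dots> \<le> card D" by (rule card_mono) (use D in auto)
    finally have "int (card (D - B)) + int (card X) \<le> int (card D)" by simp
    then show ?thesis
      using main d0s_induced_reduct[OF M(1) D(1) finh] d0s_induced_reduct[OF M(1) finX] finH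
      unfolding heavy_X by simp
  qed
  moreover have univ: "suniv ?S = runiv M" unfolding S_reduct_def by simp
  ultimately have "S_strong X ?S" using finX XM unfolding S_strong_def by simp
  moreover have "S_embedding F A ?S"
    unfolding S_embedding_def univ X_def[symmetric] using injF XM iso by simp
  ultimately have "S_strong_embedding F A ?S" unfolding S_strong_embedding_def X_def by simp
  then show ?thesis unfolding F_def .
qed

theorem theorem4p20:
  fixes M :: "'a rstr"
  assumes "R_generic M"
  shows "(S_age (S_reduct M) :: 'b sstr set) =
           {A. S_structure A \<and> finite (suniv A) \<and> S_strong {} A}
       \<and> (\<forall>A :: 'b sstr. S_structure A \<and> finite (suniv A) \<and> S_strong {} A \<longrightarrow>
             (\<exists>f. S_strong_embedding f A (S_reduct M)))"
proof -
  note M = R_generic_strong_empty[OF assms]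
  have emb: "\<exists>f. S_strong_embedding f A (S_reduct M)"
    if A: "S_structure A" "finite (suniv A)" "S_strong {} A" for A :: "'b sstr"
  proof -
    obtain e where "R_embedding e (hinge_expansion A) M" "R_strong (e ` runiv (hinge_expansion A)) M"
      using R_generic_strong_embedding[OF assms hinge_expansion_in_class_C[OF A]] by blast
    then have "S_strong_embedding (e \<circ> Inl) A (S_reduct M)"
      by (rule S_strong_embedding_if_hinge_expansion_strong[OF M A(1,2)])
    then show ?thesis by (rule exI[of _ "e \<circ> Inl"])
  qed
  have univ: "suniv (S_reduct M) = runiv M" unfolding S_reduct_def by simp
  have "S_strong {} A" if "A \<in> S_age (S_reduct M)" for A :: "'b sstr"
    using that S_strong_empty_if_iso_induced_reduct[OF M] unfolding S_age_def univ by blast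
  moreover have "A \<in> S_age (S_reduct M)"
    if A: "S_structure A" "finite (suniv A)" "S_strong {} A" for A :: "'b sstr"
  proof -
    obtain f where "S_strong_embedding f A (S_reduct M)" using emb[OF A] ..
    then have "f ` suniv A \<subseteq> suniv (S_reduct M)" "S_iso f A (S_induced (S_reduct M) (f ` suniv A))"
      unfolding S_strong_embedding_def S_embedding_def by blast+
    then show ?thesis unfolding S_age_def using A(1,2) by blast
  qed
  ultimately have "S_age (S_reduct M) = {A :: 'b sstr. S_structure A \<and> finite (suniv A) \<and> S_strong {} A}"
    unfolding S_age_def by blast
  then show ?thesis using emb by blast
qed

end
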